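(* The lattice $L2q(\mathbb{C}^4)$ of propositions of the logic of two qubits, whose elements are the six (distinct) elements $0,\,O_0,\,O_0',\,O_1,\,O_1',\,I_4$ with the partial order $O_0'\le O_0$, $O_1\le O_1'$, least element $0$ and greatest element $I_4$, is non-distributive.
   Context: Two qubits are described by two pairs of non-hermitian operators $(O_0=\lambda_0P_0,\ O_1=\lambda_1P_1)$ and $(O_0'=\lambda_0'P_0,\ O_1'=\lambda_1'P_1)$. Here $P_0,P_1$ are the one-dimensional coordinate projectors, all of $\lambda_0,\lambda_1,\lambda_0',\lambda_1'$ are nonzero complex numbers, $|\lambda_0|^2+|\lambda_1|^2=1$, $|\lambda_0'|^2+|\lambda_1'|^2=1$, and $|\lambda_0'|^2<|\lambda_0|^2$ (hence $|\lambda_1|^2<|\lambda_1'|^2$). $I_4$ is the identity and $0$ the null operator of $\mathbb{C}^4$, adjoined as top and bottom. The partial order compares, for each fixed index $i$, the range-measures $\mu(\mathrm{ran}(O_i))=|\lambda_i|^2$ and $\mu(\mathrm{ran}(O_i'))=|\lambda_i'|^2$: the operator with smaller measure is below the one with larger measure. This gives $O_0'\le O_0$ and $O_1\le O_1'$. The only order relations are these two, those making $0$ the minimum and $I_4$ the maximum, and reflexivity; elements with different indices are incomparable. Meet and join are the infimum and supremum for this order (e.g. $O_0'\vee O_1'=I_4$, $O_0\wedge O_0'=O_0'$, $O_0\wedge O_1'=0$). *)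

theory Defs
  imports "HOL-Analysis.Analysis" "HOL-Algebra.Lattice"
begin

type_synonym op4 = "complex ^ 4 ^ 4"

definition coord_proj :: "4 \<Rightarrow> op4" where
  "coord_proj k = (\<chi> i j. if i = k \<and> j = k then 1 else 0)"

definition cscale :: "complex \<Rightarrow> op4 \<Rightarrow> op4" where
  "cscale c A = map_matrix ((*) c) A"

(* For nonzero c the set ran (c P) is the coordinate axis and no longer determines c, so the
   measure that the paper writes mu (ran (c P)) = |c|^2 is taken as a function of the operator.
   It is meaningful only for scalar multiples of coordinate projectors. *)
definition range_measure :: "op4 \<Rightarrow> real" where
  "range_measure A = (THE m. \<exists>k c. A = cscale c (coord_proj k) \<and> m = (cmod c)\<^sup>2)"

lemma cscale_coord_proj_eqD:
  assumes "cscale c (coord_proj k) = cscale d (coord_proj l)"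
  shows "c = d"
proof -
  have "cscale c (coord_proj k) $ i $ i = cscale d (coord_proj l) $ i $ i" for i
    using assms by simp
  from this[of k] this[of l] show ?thesis
    by (cases "k = l") (auto simp: cscale_def coord_proj_def)
qed

lemma range_measure_cscale_coord_proj:
  "range_measure (cscale c (coord_proj k)) = (cmod c)\<^sup>2"
  unfolding range_measure_def
  by (rule the_equality) (auto dest: cscale_coord_proj_eqD)

(* The last disjunct compares operators of the same index k only. *)
definition qubit_le :: "op4 \<Rightarrow> op4 \<Rightarrow> bool" where
  "qubit_le A B \<longleftrightarrow> A = 0 \<or> B = mat 1 \<or> A = B \<or>
     (\<exists>k c d. A = cscale c (coord_proj k) \<and> B = cscale d (coord_proj k) \<and>
              range_measure A \<le> range_measure B)"

(* The parameters are the two coordinate indices of P_0, P_1 and the scalars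
   lambda_0, lambda_1, lambda'_0, lambda'_1. *)
definition L2q ::
  "4 \<Rightarrow> 4 \<Rightarrow> complex \<Rightarrow> complex \<Rightarrow> complex \<Rightarrow> complex \<Rightarrow> op4 gorder" where
  "L2q k0 k1 l0 l1 l0' l1' =
     \<lparr> carrier = {0, cscale l0 (coord_proj k0), cscale l0' (coord_proj k0),
                  cscale l1 (coord_proj k1), cscale l1' (coord_proj k1), mat 1},
       eq = (=),
       le = qubit_le \<rparr>"

locale distributive_lattice = lattice +
  assumes meet_join_distrib:
    "\<lbrakk>x \<in> carrier L; y \<in> carrier L; z \<in> carrier L\<rbrakk>
      \<Longrightarrow> x \<sqinter> (y \<squnion> z) = (x \<sqinter> y) \<squnion> (x \<sqinter> z)"

end

(* The chain 0 < O0' < O0 < I_4 together with O1 forms the pentagon N5: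
   O0 \<and> (O0' \<or> O1) = O0 \<and> I_4 = O0, whereas (O0 \<and> O0') \<or> (O0 \<and> O1) = O0' \<or> 0 = O0'. *)
theory Submission
  imports Defs
begin

text \<open>The order consists of two chains \<open>z < a' < a < t\<close> and
  \<open>z < b < b' < t\<close> that meet only at their ends. Interior elements of different chains
  have \<open>t\<close> as their only common upper bound and \<open>z\<close> as their only common
  lower bound, so all joins and meets exist. Distributivity fails, since it would force \<open>a = a
  \<sqinter> (a' \<squnion> b) = (a \<sqinter> a') \<squnion> (a \<sqinter> b) = a'\<close>. That
  the operators form such a hexagon rests on \<open>qubit_le_cscale_coord_proj_iff\<close>: nonzero
  multiples of coordinate projectors are comparable only for equal index, and then by modulus.
  Normalization makes the second pair ordered oppositely to the first.\<close>

locale hexagon =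
  fixes L :: "'a gorder" (structure) and z t a a' b b' :: 'a
  assumes distinct_elems: "distinct [z, a, a', b, b', t]"
    and carrier_eq: "carrier L = {z, a, a', b, b', t}"
    and eq_eq: "(.=) = (=)"
    and le_iff: "\<lbrakk>x \<in> carrier L; y \<in> carrier L\<rbrakk> \<Longrightarrow>
      x \<sqsubseteq> y \<longleftrightarrow> x = y \<or> x = z \<or> y = t \<or> (x = a' \<and> y = a) \<or> (x = b \<and> y = b')"
begin

lemma partial_order: "partial_order L"
proof
  fix x y w
  assume "x \<sqsubseteq> y" "y \<sqsubseteq> w" "x \<in> carrier L" "y \<in> carrier L" "w \<in> carrier L"
  then show "x \<sqsubseteq> w"
    using distinct_elems by (auto simp: le_iff)
next
  fix x y
  assume "x \<sqsubseteq> y" "y \<sqsubseteq> x" "x \<in> carrier L" "y \<in> carrier L"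
  then show "x .= y"
    using distinct_elems by (auto simp: le_iff eq_eq)
qed (auto simp: eq_eq le_iff)

text \<open>Of two comparable elements the larger is the supremum. Incomparable ones are interior to
  different chains, which leaves \<open>t\<close> as the only upper bound.\<close>

lemma sup_of_two_exists:
  assumes "x \<in> carrier L" "y \<in> carrier L"
  shows "\<exists>s. least L s (Upper L {x, y})"
proof -
  interpret partial_order L by (rule partial_order)
  consider "x \<sqsubseteq> y" | "y \<sqsubseteq> x" | "\<not> x \<sqsubseteq> y" "\<not> y \<sqsubseteq> x" by blast
  then show ?thesis
  proof cases
    case 1
    then have "least L y (Upper L {x, y})"
      using assms by (auto simp: least_def Upper_def)
    then show ?thesis ..
  next
    case 2
    then have "least L x (Upper L {x, y})"
      using assms by (auto simp: least_def Upper_def)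
    then show ?thesis ..
  next
    case 3
    have t: "t \<in> carrier L"
      using carrier_eq by simp
    have "t \<sqsubseteq> u" if "u \<in> carrier L" "x \<sqsubseteq> u" "y \<sqsubseteq> u" for u
    proof -
      have "u = t"
        using 3 that assms distinct_elems by (simp add: le_iff) metis
      then show ?thesis
        using t by simp
    qed
    then have "least L t (Upper L {x, y})"
      using assms t by (auto simp: least_def Upper_def le_iff[of _ t])
    then show ?thesis ..
  qed
qed

text \<open>Reversing the order swaps \<open>z\<close> with \<open>t\<close> and the two interior
  elements of each chain, so infima come from suprema by duality.\<close>

lemma dual_hexagon: "hexagon (inv_gorder L) t z a' a b' b"
  using distinct_elems carrier_eq eq_eq by unfold_locales (auto simp: le_iff)

lemma bounded_lattice: "bounded_lattice L"
proof -
  interpret partial_order L by (rule partial_order)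
  interpret dual: hexagon "inv_gorder L" t z a' a b' b by (rule dual_hexagon)
  show ?thesis
  proof
    fix x y
    assume xy: "x \<in> carrier L" "y \<in> carrier L"
    then show "\<exists>s. least L s (Upper L {x, y})" by (rule sup_of_two_exists)
    show "\<exists>s. greatest L s (Lower L {x, y})"
      using dual.sup_of_two_exists[of x y] xy by simp
  next
    have "least L z (carrier L)"
      using carrier_eq by (auto simp: least_def le_iff)
    then show "\<exists>x. least L x (carrier L)" ..
  next
    have "greatest L t (carrier L)"
      using carrier_eq by (auto simp: greatest_def le_iff)
    then show "\<exists>x. greatest L x (carrier L)" ..
  qed
qed

lemma not_distributive: "\<not> distributive_lattice L"
proof
  assume "distributive_lattice L"
  then interpret distributive_lattice L .
  have in_carrier: "z \<in> carrier L" "a \<in> carrier L" "a' \<in> carrier L" "b \<in> carrier L" "t \<in> carrier L"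
    using carrier_eq by auto
  have "a' \<squnion> b = t"
    using join_left[of a' b] join_right[of a' b] in_carrier distinct_elems
    by (auto simp: le_iff)
  then have "a \<sqsubseteq> a' \<squnion> b"
    using in_carrier by (simp add: le_iff)
  then have "a \<sqsubseteq> a \<sqinter> (a' \<squnion> b)"
    using in_carrier by (intro meet_le) simp_all
  moreover have "a \<sqinter> b = z"
    using meet_left[of a b] meet_right[of a b] in_carrier distinct_elems
    by (auto simp: le_iff)
  moreover have "a \<sqinter> a' \<squnion> z \<sqsubseteq> a'"
    using in_carrier meet_right[of a a'] by (intro join_le) (auto simp: le_iff)
  \<comment> \<open>Distributivity and \<open>a \<sqinter> b = z\<close> turn the upper bound
    \<open>a \<sqinter> (a' \<squnion> b)\<close> of \<open>a\<close> into
    \<open>a \<sqinter> a' \<squnion> z\<close>, which lies below \<open>a'\<close>.\<close>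
  ultimately have "a \<sqsubseteq> a'"
    using meet_join_distrib[of a a' b] in_carrier le_trans[of a "a \<sqinter> a' \<squnion> z" a'] by auto
  then show False
    using in_carrier distinct_elems by (auto simp: le_iff)
qed

end

text \<open>The entry at \<open>(k, k)\<close> is \<open>c\<close> on the left, and being nonzero it
  forces \<open>l = k\<close>. For \<open>c = 0\<close> the index would be lost.\<close>

lemma cscale_coord_proj_eq_iff:
  assumes "c \<noteq> 0"
  shows "cscale c (coord_proj k) = cscale d (coord_proj l) \<longleftrightarrow> c = d \<and> k = l"
proof
  assume eq: "cscale c (coord_proj k) = cscale d (coord_proj l)"
  then have "cscale c (coord_proj k) $ k $ k = cscale d (coord_proj l) $ k $ k"
    by simp
  with assms cscale_coord_proj_eqD[OF eq] show "c = d \<and> k = l"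
    by (auto simp: cscale_def coord_proj_def split: if_splits)
qed simp

lemma cscale_coord_proj_eq_0_iff: "cscale c (coord_proj k) = 0 \<longleftrightarrow> c = 0"
  by (auto simp: cscale_def coord_proj_def vec_eq_iff)

lemma cscale_coord_proj_neq_mat_1: "cscale c (coord_proj k) \<noteq> mat 1"
proof
  assume eq: "cscale c (coord_proj k) = mat 1"
  \<comment> \<open>A diagonal entry off \<open>k\<close> is 0 on the left and 1 in the identity;
    one of the indices 0 and 1 differs from \<open>k\<close>.\<close>
  obtain i :: 4 where "i \<noteq> k"
    by (metis zero_neq_one)
  then show False
    using arg_cong[OF eq, of "\<lambda>A. A $ i $ i"] by (simp add: cscale_def coord_proj_def mat_def)
qed

text \<open>A nonzero multiple determines its index and scalar, so the witnesses in
  \<open>qubit_le\<close> are forced and only the comparison of squared moduli remains.\<close>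

lemma qubit_le_cscale_coord_proj_iff:
  assumes "c \<noteq> 0" "d \<noteq> 0"
  shows "qubit_le (cscale c (coord_proj k)) (cscale d (coord_proj l)) \<longleftrightarrow>
    k = l \<and> cmod c \<le> cmod d"
  unfolding qubit_le_def range_measure_cscale_coord_proj
  using assms
  by (auto simp: cscale_coord_proj_eq_iff cscale_coord_proj_eq_0_iff cscale_coord_proj_neq_mat_1)

lemma zero_neq_mat_1: "(0 :: op4) \<noteq> mat 1"
  by (auto simp: vec_eq_iff mat_def)

text \<open>Since 0 is itself the zero multiple of every projector, the measure comparison in
  \<open>qubit_le\<close> may apply to it; its measure is 0, which forces the scalar of
  \<open>A\<close> to vanish.\<close>

lemma qubit_le_0_iff: "qubit_le A 0 \<longleftrightarrow> A = 0"
proof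
  assume "qubit_le A 0"
  then consider "A = 0" | k c d where "A = cscale c (coord_proj k)" "0 = cscale d (coord_proj k)"
      "range_measure A \<le> range_measure 0"
    using zero_neq_mat_1 unfolding qubit_le_def by blast
  then show "A = 0"
  proof cases
    case 2
    then have "d = 0" by (metis cscale_coord_proj_eq_0_iff)
    then have "(cmod c)\<^sup>2 \<le> 0"
      using 2 by (metis norm_zero range_measure_cscale_coord_proj zero_power2)
    then show ?thesis
      using 2 by (simp add: cscale_coord_proj_eq_0_iff)
  qed
qed (simp add: qubit_le_def)

lemma mat_1_qubit_le_iff: "qubit_le (mat 1) B \<longleftrightarrow> B = mat 1"
  by (auto simp: qubit_le_def zero_neq_mat_1[symmetric] cscale_coord_proj_neq_mat_1[symmetric])

theorem mainTheorem6:
  fixes k0 k1 :: 4 and l0 l1 l0' l1' :: complex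
    and O0 O1 O0' O1' :: op4 and L :: "op4 gorder"
  assumes "k0 \<noteq> k1"
    and "l0 \<noteq> 0" "l1 \<noteq> 0" "l0' \<noteq> 0" "l1' \<noteq> 0"
    and "(cmod l0)\<^sup>2 + (cmod l1)\<^sup>2 = 1"
    and "(cmod l0')\<^sup>2 + (cmod l1')\<^sup>2 = 1"
    and "(cmod l0')\<^sup>2 < (cmod l0)\<^sup>2"
  defines "O0 \<equiv> cscale l0 (coord_proj k0)"
    and "O1 \<equiv> cscale l1 (coord_proj k1)"
    and "O0' \<equiv> cscale l0' (coord_proj k0)"
    and "O1' \<equiv> cscale l1' (coord_proj k1)"
    and "L \<equiv> L2q k0 k1 l0 l1 l0' l1'"
  shows "distinct [0, O0, O0', O1, O1', mat 1]
    \<and> carrier L = {0, O0, O0', O1, O1', mat 1}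
    \<and> (\<forall>A \<in> carrier L. \<forall>B \<in> carrier L.
         A \<sqsubseteq>\<^bsub>L\<^esub> B \<longleftrightarrow>
           A = B \<or> A = 0 \<or> B = mat 1 \<or> (A = O0' \<and> B = O0) \<or> (A = O1 \<and> B = O1'))
    \<and> bounded_lattice L
    \<and> \<not> distributive_lattice L"
proof -
  \<comment> \<open>By normalization, \<open>(cmod l1)\<^sup>2 = 1 - (cmod l0)\<^sup>2 < 1 - (cmod
    l0')\<^sup>2 = (cmod l1')\<^sup>2\<close>.\<close>
  have less0: "cmod l0' < cmod l0" and less1: "cmod l1 < cmod l1'"
    using assms(6-8) by (auto intro: power2_less_imp_less)
  then have neq: "l0 \<noteq> l0'" "l1 \<noteq> l1'" by auto
  note eqs = cscale_coord_proj_eq_iff cscale_coord_proj_eq_0_iff cscale_coord_proj_neq_mat_1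
    cscale_coord_proj_neq_mat_1[symmetric] zero_neq_mat_1 zero_neq_mat_1[symmetric]
  have zero_neq: "0 \<noteq> cscale c (coord_proj k)" if "c \<noteq> 0" for c k
    using that by (metis cscale_coord_proj_eq_0_iff)
  have qubit_le_0: "qubit_le 0 A" and qubit_le_1: "qubit_le A (mat 1)" for A
    by (auto simp: qubit_le_def)
  have dist: "distinct [0, O0, O0', O1, O1', mat 1]"
    using assms(1-5) neq
    by (simp add: O0_def O0'_def O1_def O1'_def eqs zero_neq)
  have carr: "carrier L = {0, O0, O0', O1, O1', mat 1}"
    by (simp add: L_def L2q_def O0_def O0'_def O1_def O1'_def)
  have le: "\<forall>A \<in> carrier L. \<forall>B \<in> carrier L. A \<sqsubseteq>\<^bsub>L\<^esub> B \<longleftrightarrow>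
      A = B \<or> A = 0 \<or> B = mat 1 \<or> (A = O0' \<and> B = O0) \<or> (A = O1 \<and> B = O1')"
  proof -
    have "le L = qubit_le"
      by (simp add: L_def L2q_def)
    moreover have
      "qubit_le O0' O0" "\<not> qubit_le O0 O0'" "qubit_le O1 O1'" "\<not> qubit_le O1' O1"
      "qubit_le O0 O0" "qubit_le O0' O0'" "qubit_le O1 O1" "qubit_le O1' O1'"
      "\<not> qubit_le O0 O1" "\<not> qubit_le O0 O1'" "\<not> qubit_le O0' O1" "\<not> qubit_le O0' O1'"
      "\<not> qubit_le O1 O0" "\<not> qubit_le O1 O0'" "\<not> qubit_le O1' O0" "\<not> qubit_le O1' O0'"
      using assms(1-5) less0 less1
      by (simp_all add: O0_def O0'_def O1_def O1'_def qubit_le_cscale_coord_proj_iff)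
    ultimately show ?thesis
      using dist unfolding carr
      by (auto simp: qubit_le_0 qubit_le_1 qubit_le_0_iff mat_1_qubit_le_iff)
  qed
  \<comment> \<open>The primed operator is the lower one in the chain of \<open>k0\<close> but the
    upper one in the chain of \<open>k1\<close>, matching \<open>a' < a\<close> and
    \<open>b < b'\<close>.\<close>
  interpret hexagon L 0 "mat 1" O0 O0' O1 O1'
  proof
    show "eq L = (=)"
      by (simp add: L_def L2q_def)
  qed (fact dist, fact carr, rule le[rule_format])
  show ?thesis
    using dist carr le bounded_lattice not_distributive by (intro conjI)
qed

end
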